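(* Let $G$ be a circulant. Then $G$ is a CIS graph if and only if all of the following hold: every maximal stable set of $G$ has size $\alpha(G)$, every maximal clique of $G$ has size $\omega(G)$, and $\alpha(G)\,\omega(G)=|V(G)|$. In particular, both $G$ and its complement $\overline{G}$ are well-covered whenever $G$ is a CIS circulant.
   Context: Graphs are finite, undirected, without loops or multiple edges. For a positive integer $n$ write $[n]=\{1,\dots,n\}$, and $[0]=\emptyset$. Given a positive integer $n$ and a set $D\subseteq[n-1]$ such that $d\in D\Leftrightarrow n-d\in D$, the circulant $C_n(D)$ is the graph with vertex set $\mathbb{Z}_n$ in which two distinct vertices $i,j$ are adjacent if and only if $i-j \pmod n\in D$. A clique (stable set) is a set of pairwise adjacent (non-adjacent) vertices; "maximal" means maximal with respect to inclusion. $\omega(G)$ and $\alpha(G)$ denote the maximum sizes of a clique and of a stable set of $G$. A graph is well-covered if all its maximal stable sets have size $\alpha(G)$. A graph is CIS if every maximal clique and every maximal stable set of it have a common vertex. *)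

theory Defs
  imports "HOL-Library.Ramsey"
begin

text \<open>
  Graphs are given by a vertex set and a set of two-element vertex sets. \<^const>\<open>clique\<close> and
  \<^const>\<open>indep\<close> from \<^theory>\<open>HOL-Library.Ramsey\<close> do not mention the ambient vertex set, so
  containment in it is required separately below.
\<close>

record 'a graph =
  verts :: "'a set"
  edges :: "'a set set"

definition fin_simple_graph :: "'a graph \<Rightarrow> bool" where
  "fin_simple_graph G \<longleftrightarrow> finite (verts G) \<and> edges G \<subseteq> [verts G]\<^bsup>2\<^esup>"

definition complement_graph :: "'a graph \<Rightarrow> 'a graph" where
  "complement_graph G = \<lparr>verts = verts G, edges = [verts G]\<^bsup>2\<^esup> - edges G\<rparr>"

definition is_clique :: "'a graph \<Rightarrow> 'a set \<Rightarrow> bool" where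
  "is_clique G K \<longleftrightarrow> K \<subseteq> verts G \<and> clique K (edges G)"

definition is_stable :: "'a graph \<Rightarrow> 'a set \<Rightarrow> bool" where
  "is_stable G S \<longleftrightarrow> S \<subseteq> verts G \<and> indep S (edges G)"

definition maximal_clique :: "'a graph \<Rightarrow> 'a set \<Rightarrow> bool" where
  "maximal_clique G K \<longleftrightarrow> is_clique G K \<and> (\<forall>K'. is_clique G K' \<and> K \<subseteq> K' \<longrightarrow> K' = K)"

definition maximal_stable :: "'a graph \<Rightarrow> 'a set \<Rightarrow> bool" where
  "maximal_stable G S \<longleftrightarrow> is_stable G S \<and> (\<forall>S'. is_stable G S' \<and> S \<subseteq> S' \<longrightarrow> S' = S)"

definition clique_number :: "'a graph \<Rightarrow> nat" where
  "clique_number G = Max (card ` {K. is_clique G K})"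

definition stability_number :: "'a graph \<Rightarrow> nat" where
  "stability_number G = Max (card ` {S. is_stable G S})"

definition well_covered :: "'a graph \<Rightarrow> bool" where
  "well_covered G \<longleftrightarrow> (\<forall>S. maximal_stable G S \<longrightarrow> card S = stability_number G)"

definition CIS :: "'a graph \<Rightarrow> bool" where
  "CIS G \<longleftrightarrow> (\<forall>K S. maximal_clique G K \<and> maximal_stable G S \<longrightarrow> K \<inter> S \<noteq> {})"

text \<open>\<open>\<int>\<^sub>n\<close> is represented by the residues \<open>0, \<dots>, n - 1\<close>.\<close>

definition circulant :: "int \<Rightarrow> int set \<Rightarrow> int graph" where
  "circulant n D =
     \<lparr>verts = {0..<n},
      edges = {{i, j} | i j. i \<in> {0..<n} \<and> j \<in> {0..<n} \<and> i \<noteq> j \<and> (i - j) mod n \<in> D}\<rparr>"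

lemma fin_simple_graph_circulant: "fin_simple_graph (circulant n D)"
  by (auto simp: fin_simple_graph_def circulant_def nsets_def)

lemma circulant_edge_iff:
  assumes "D \<subseteq> {1..n - 1}" and "\<forall>d \<in> {1..n - 1}. d \<in> D \<longleftrightarrow> n - d \<in> D"
    and "i \<in> {0..<n}" and "j \<in> {0..<n}" and "i \<noteq> j"
  shows "{i, j} \<in> edges (circulant n D) \<longleftrightarrow> (i - j) mod n \<in> D"
proof -
  have "(j - i) mod n = n - (i - j) mod n"
    using zmod_zminus1_eq_if[of "i - j" n] assms(3-5)
    by (smt (verit, best) atLeastLessThan_iff mod_diff_cong mod_pos_pos_trivial)
  with assms have "(j - i) mod n \<in> D \<longleftrightarrow> (i - j) mod n \<in> D"
    by (smt (verit, best) atLeastAtMost_iff subsetD)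
  with assms show ?thesis
    by (auto simp: circulant_def doubleton_eq_iff)
qed

end

theory Submission
  imports Defs
begin

text \<open>
  Let \<open>K\<close> be a clique and \<open>S\<close> a stable set of a circulant on \<open>n\<close> vertices. The difference map
  \<open>K \<times> S \<rightarrow> \<int>\<^sub>n\<close>, \<open>(k, s) \<mapsto> s - k\<close>, is injective: if \<open>s - k = s' - k'\<close>, then
  \<open>s - s' = k - k'\<close>, and a nonzero common value would lie in \<open>D\<close> because \<open>K\<close> is a clique and outside
  \<open>D\<close> because \<open>S\<close> is stable. Hence \<open>|K| |S| \<le> n\<close>, with equality exactly when every residue is a
  difference. The residue \<open>t\<close> is a difference exactly when the translate \<open>K + t\<close> meets \<open>S\<close>.

  Translates of maximal cliques are maximal cliques. So if the circulant is CIS, every residue is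
  attained and \<open>|K| |S| = n\<close> for all maximal \<open>K\<close> and \<open>S\<close>; comparing with a largest clique and a largest
  stable set shows that \<open>|K|\<close> and \<open>|S|\<close> do not depend on the choice of \<open>K\<close> and \<open>S\<close>. Conversely, if
  \<open>|K| |S| = n\<close>, then the residue \<open>0\<close> is attained, which says that \<open>K\<close> and \<open>S\<close> intersect. The two
  directions are \<open>card_mult_of_CIS\<close> and \<open>intersect_of_card_mult\<close>; both rest on
  \<open>inj_on_difference\<close>.
\<close>

section \<open>Maximum cliques and stable sets of finite graphs\<close>

lemma maximum_clique:
  assumes "finite (verts G)"
  obtains K where "maximal_clique G K" "card K = clique_number G"
proof -
  let ?F = "{K. is_clique G K}"
  have "?F \<subseteq> Pow (verts G)" by (auto simp: is_clique_def)
  then have fin: "finite ?F" using assms by (meson finite_Pow_iff finite_subset)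
  have "{} \<in> ?F" by (simp add: is_clique_def clique_def)
  then have "clique_number G \<in> card ` ?F"
    unfolding clique_number_def using fin by (intro Max_in) auto
  then obtain K where K: "is_clique G K" "card K = clique_number G" by auto
  have "K' = K" if "is_clique G K'" "K \<subseteq> K'" for K'
  proof -
    have "card K' \<le> card K"
      unfolding K(2) clique_number_def using fin that(1) by (intro Max_ge) auto
    moreover have "finite K'" using that(1) assms by (auto simp: is_clique_def intro: finite_subset)
    ultimately show ?thesis using that(2) card_seteq by blast
  qed
  with K show thesis by (intro that) (auto simp: maximal_clique_def)
qed

lemma is_stable_complement_graph: "is_stable (complement_graph G) S \<longleftrightarrow> is_clique G S"
proof -
  have "{u, v} \<in> [verts G]\<^bsup>2\<^esup>" if "u \<in> verts G" "v \<in> verts G" "u \<noteq> v" for u v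
    using that by (auto simp: nsets_def)
  then show ?thesis
    by (auto simp: is_stable_def is_clique_def complement_graph_def indep_def clique_def subset_iff)
qed

lemma is_clique_complement_graph: "is_clique (complement_graph G) S \<longleftrightarrow> is_stable G S"
proof -
  have "{u, v} \<in> [verts G]\<^bsup>2\<^esup>" if "u \<in> verts G" "v \<in> verts G" "u \<noteq> v" for u v
    using that by (auto simp: nsets_def)
  then show ?thesis
    by (auto simp: is_stable_def is_clique_def complement_graph_def indep_def clique_def subset_iff)
qed

lemma maximum_stable:
  assumes "finite (verts G)"
  obtains S where "maximal_stable G S" "card S = stability_number G"
proof -
  have "finite (verts (complement_graph G))" using assms by (simp add: complement_graph_def)
  from maximum_clique[OF this] that show thesis
    by (auto simp: maximal_clique_def clique_number_def maximal_stable_def stability_number_def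
        is_clique_complement_graph)
qed

lemma well_covered_complement_graph:
  "well_covered (complement_graph G) \<longleftrightarrow> (\<forall>K. maximal_clique G K \<longrightarrow> card K = clique_number G)"
  by (simp add: well_covered_def maximal_stable_def maximal_clique_def stability_number_def
      clique_number_def is_stable_complement_graph)

section \<open>Translates and differences in a circulant\<close>

lemma residue_eqI:
  fixes x y n :: int
  assumes "(x - y) mod n = 0" "x \<in> {0..<n}" "y \<in> {0..<n}"
  shows "x = y"
  using assms by (metis atLeastLessThan_iff mod_0_imp_dvd mod_eq_dvd_iff mod_pos_pos_trivial)

definition translate :: "int \<Rightarrow> int \<Rightarrow> int set \<Rightarrow> int set" where
  "translate n t X = (\<lambda>x. (x + t) mod n) ` X"

lemma translate_subset: "n \<ge> 1 \<Longrightarrow> translate n t X \<subseteq> {0..<n}"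
  by (auto simp: translate_def)

lemma translate_translate_uminus:
  assumes "X \<subseteq> {0..<n}"
  shows "translate n t (translate n (- t) X) = X"
proof -
  have "translate n t (translate n (- t) X) = (\<lambda>x. x) ` X"
    unfolding translate_def image_image
    by (rule image_cong) (use assms in \<open>auto simp: mod_add_left_eq\<close>)
  then show ?thesis by simp
qed

locale circulant_graph =
  fixes n :: int and D :: "int set"
  assumes n_pos: "n \<ge> 1"
    and D_subset: "D \<subseteq> {1..n - 1}"
    and D_sym: "\<forall>d \<in> {1..n - 1}. d \<in> D \<longleftrightarrow> n - d \<in> D"
begin

abbreviation "C \<equiv> circulant n D"

lemma verts_C: "verts C = {0..<n}"
  by (simp add: circulant_def)

lemma is_clique_iff:
  "is_clique C K \<longleftrightarrow> K \<subseteq> {0..<n} \<and> (\<forall>i\<in>K. \<forall>j\<in>K. i \<noteq> j \<longrightarrow> (i - j) mod n \<in> D)"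
  unfolding is_clique_def clique_def verts_C
  using circulant_edge_iff[OF D_subset D_sym] by (meson subsetD)

lemma is_stable_iff:
  "is_stable C S \<longleftrightarrow> S \<subseteq> {0..<n} \<and> (\<forall>i\<in>S. \<forall>j\<in>S. i \<noteq> j \<longrightarrow> (i - j) mod n \<notin> D)"
  unfolding is_stable_def indep_def verts_C
  using circulant_edge_iff[OF D_subset D_sym] by (meson subsetD)

lemma is_clique_translate:
  assumes "is_clique C K"
  shows "is_clique C (translate n t K)"
  unfolding is_clique_iff
proof (intro conjI ballI impI)
  show "translate n t K \<subseteq> {0..<n}" by (rule translate_subset[OF n_pos])
  fix i j assume "i \<in> translate n t K" "j \<in> translate n t K" "i \<noteq> j"
  then obtain x y where xy: "x \<in> K" "y \<in> K" "i = (x + t) mod n" "j = (y + t) mod n"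
    by (auto simp: translate_def)
  with \<open>i \<noteq> j\<close> have "x \<noteq> y" by auto
  moreover have "(i - j) mod n = (x - y) mod n"
    using xy by (simp add: mod_diff_eq)
  ultimately show "(i - j) mod n \<in> D"
    using xy assms by (auto simp: is_clique_iff)
qed

text \<open>A clique containing \<open>K + t\<close> can be translated back to one containing \<open>K\<close>.\<close>

lemma maximal_clique_translate:
  assumes "maximal_clique C K"
  shows "maximal_clique C (translate n t K)"
  unfolding maximal_clique_def
proof (intro conjI allI impI; (elim conjE)?)
  have K: "is_clique C K" "K \<subseteq> {0..<n}"
    using assms by (auto simp: maximal_clique_def is_clique_iff)
  show "is_clique C (translate n t K)" using K(1) by (rule is_clique_translate)
  fix K' assume K': "is_clique C K'" "translate n t K \<subseteq> K'"
  have "translate n (- t) (translate n t K) \<subseteq> translate n (- t) K'"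
    using K'(2) by (auto simp: translate_def)
  then have "K \<subseteq> translate n (- t) K'"
    using translate_translate_uminus[OF K(2), of "- t"] by simp
  then have "translate n (- t) K' = K"
    using assms is_clique_translate[OF K'(1)] by (auto simp: maximal_clique_def)
  then show "K' = translate n t K"
    using translate_translate_uminus[of K' n t] K'(1) by (simp add: is_clique_iff)
qed

text \<open>
  Two pairs with the same difference satisfy \<open>s - s' = k - k'\<close> in \<open>\<int>\<^sub>n\<close>, and distinct vertices of a
  clique never have the same difference as distinct vertices of a stable set.
\<close>

lemma inj_on_difference:
  assumes "is_clique C K" "is_stable C S"
  shows "inj_on (\<lambda>(k, s). (s - k) mod n) (K \<times> S)"
proof (rule inj_onI, clarsimp)
  fix k s k' s'
  assume mem: "k \<in> K" "s \<in> S" "k' \<in> K" "s' \<in> S" and eq: "(s - k) mod n = (s' - k') mod n"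
  have res: "k \<in> {0..<n}" "k' \<in> {0..<n}" "s \<in> {0..<n}" "s' \<in> {0..<n}"
    using mem assms by (auto simp: is_clique_iff is_stable_iff)
  have diff: "(s - s') mod n = (k - k') mod n"
    using eq by (simp add: mod_eq_dvd_iff algebra_simps)
  have "0 \<notin> D" using D_subset by auto
  show "k = k' \<and> s = s'"
  proof (cases "k = k'")
    case True
    then show ?thesis using diff residue_eqI[of s s' n] res by simp
  next
    case False
    then have "(s - s') mod n \<in> D" using assms(1) mem diff by (auto simp: is_clique_iff)
    moreover from this have "s \<noteq> s'" using \<open>0 \<notin> D\<close> by auto
    ultimately show ?thesis using assms(2) mem by (auto simp: is_stable_iff)
  qed
qed

lemma card_differences:
  assumes "is_clique C K" "is_stable C S"
  shows "card ((\<lambda>(k, s). (s - k) mod n) ` (K \<times> S)) = card K * card S"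
  using card_image[OF inj_on_difference[OF assms]] by (simp add: card_cartesian_product)

lemma card_mult_of_CIS:
  assumes "CIS C" "maximal_clique C K" "maximal_stable C S"
  shows "card K * card S = card (verts C)"
proof -
  have KS: "is_clique C K" "is_stable C S"
    using assms by (auto simp: maximal_clique_def maximal_stable_def)
  have "(\<lambda>(k, s). (s - k) mod n) ` (K \<times> S) = {0..<n}"
  proof
    show "(\<lambda>(k, s). (s - k) mod n) ` (K \<times> S) \<subseteq> {0..<n}" using n_pos by auto
    show "{0..<n} \<subseteq> (\<lambda>(k, s). (s - k) mod n) ` (K \<times> S)"
    proof
      fix t assume t: "t \<in> {0..<n}"
      have "translate n t K \<inter> S \<noteq> {}"
        using assms maximal_clique_translate unfolding CIS_def by blast
      then obtain k where k: "k \<in> K" "(k + t) mod n \<in> S" by (auto simp: translate_def)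
      have "((k + t) mod n - k) mod n = t" using t by (simp add: mod_diff_left_eq)
      with k show "t \<in> (\<lambda>(k, s). (s - k) mod n) ` (K \<times> S)" by force
    qed
  qed
  with card_differences[OF KS] show ?thesis by (simp add: verts_C)
qed

lemma intersect_of_card_mult:
  assumes "is_clique C K" "is_stable C S" "card K * card S = card (verts C)"
  shows "K \<inter> S \<noteq> {}"
proof -
  have "(\<lambda>(k, s). (s - k) mod n) ` (K \<times> S) = {0..<n}"
  proof (rule card_subset_eq)
    show "(\<lambda>(k, s). (s - k) mod n) ` (K \<times> S) \<subseteq> {0..<n}" using n_pos by auto
  qed (use card_differences assms verts_C in auto)
  moreover have "0 \<in> {0..<n}" using n_pos by simp
  ultimately have "0 \<in> (\<lambda>(k, s). (s - k) mod n) ` (K \<times> S)" by (simp only:)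
  then obtain k s where ks: "k \<in> K" "s \<in> S" "(s - k) mod n = 0" by auto
  moreover have "k \<in> {0..<n}" "s \<in> {0..<n}"
    using ks assms(1,2) by (auto simp: is_clique_iff is_stable_iff)
  ultimately have "s = k" by (intro residue_eqI[of s k n])
  with ks show ?thesis by blast
qed

theorem CIS_iff:
  "CIS C \<longleftrightarrow>
    (\<forall>S. maximal_stable C S \<longrightarrow> card S = stability_number C) \<and>
    (\<forall>K. maximal_clique C K \<longrightarrow> card K = clique_number C) \<and>
    stability_number C * clique_number C = card (verts C)"
  (is "_ \<longleftrightarrow> ?stable \<and> ?clique \<and> ?product")
proof
  assume CIS: "CIS C"
  have "finite (verts C)" by (simp add: verts_C)
  then obtain K\<^sub>0 S\<^sub>0 where
    max: "maximal_clique C K\<^sub>0" "card K\<^sub>0 = clique_number C"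
      "maximal_stable C S\<^sub>0" "card S\<^sub>0 = stability_number C"
    using maximum_clique maximum_stable by metis
  have prod: "clique_number C * stability_number C = card (verts C)"
    using card_mult_of_CIS[OF CIS max(1,3)] max by simp
  \<comment> \<open>Both factors are nonzero because there is a vertex, so they can be cancelled.\<close>
  moreover have "card (verts C) > 0" using n_pos by (simp add: verts_C)
  ultimately have pos: "clique_number C > 0" "stability_number C > 0"
    by (metis gr0I mult_0 mult_0_right)+
  have ?stable
    using card_mult_of_CIS[OF CIS max(1)] max(2) prod pos by (metis mult_left_cancel not_gr0)
  moreover have ?clique
    using card_mult_of_CIS[OF CIS _ max(3)] max(4) prod pos by (metis mult_right_cancel not_gr0)
  ultimately show "?stable \<and> ?clique \<and> ?product" using prod by (simp add: mult.commute)
next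
  assume "?stable \<and> ?clique \<and> ?product"
  then show "CIS C"
    using intersect_of_card_mult
    by (auto simp: CIS_def maximal_clique_def maximal_stable_def mult.commute)
qed

end

section \<open>CIS circulants\<close>

theorem theorem1:
  fixes n :: int and D :: "int set" and G :: "int graph"
  assumes "n \<ge> 1"
    and "D \<subseteq> {1..n - 1}"
    and "\<forall>d \<in> {1..n - 1}. d \<in> D \<longleftrightarrow> n - d \<in> D"
    and "G = circulant n D"
  shows "(CIS G \<longleftrightarrow>
            (\<forall>S. maximal_stable G S \<longrightarrow> card S = stability_number G) \<and>
            (\<forall>K. maximal_clique G K \<longrightarrow> card K = clique_number G) \<and>
            stability_number G * clique_number G = card (verts G)) \<and>
         (CIS G \<longrightarrow> well_covered G \<and> well_covered (complement_graph G))"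
proof -
  interpret circulant_graph n D using assms(1-3) by unfold_locales
  show ?thesis
    unfolding assms(4) well_covered_complement_graph well_covered_def[of C] using CIS_iff by blast
qed

end
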